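(* If $X$ and $Y$ are two quasi-isometric proper geodesic metric spaces, then they have the same divergence spectrum, i.e. $S_X=S_Y$.
   Context: **Equivalence of functions.** For functions $f,g:[0,\infty)\to[0,\infty]$, $f\preceq g$ if there are positive constants $A,B,C,D$ with $f(x)\le Ag(Bx)+Cx$ for all $x>D$; $f\sim g$ if $f\preceq g$ and $g\preceq f$. (Values at $0$ are irrelevant.) **Quasi-isometries and geodesics.** A map $\Phi:X\to Y$ is a $(K,L)$-quasi-isometric embedding if $\frac1K d_X(x_1,x_2)-L\le d_Y(\Phi(x_1),\Phi(x_2))\le K d_X(x_1,x_2)+L$ for all $x_1,x_2\in X$; it is a $(K,L)$-quasi-isometry if in addition the $L$-neighborhood of $\Phi(X)$ is $Y$. $X$ and $Y$ are quasi-isometric if there is a $(K,L)$-quasi-isometry $X\to Y$ for some $K,L$. A $(K,L)$-quasi-geodesic is a $(K,L)$-quasi-isometric embedding of an interval of $\mathbb{R}$; a geodesic is a $(1,0)$-quasi-geodesic. A quasi-geodesic $\gamma$ is Morse if for all $K\ge1$, $L>0$ there is a constant $M=M(K,L)$ such that every $(K,L)$-quasi-geodesic with endpoints on $\gamma$ lies in the $M$-neighborhood of $\gamma$. **Divergence spectrum.** For a bi-infinite geodesic $\alpha$, $r>0$ and $t\in\mathbb{R}$, let $\rho_\alpha(r,t)$ be the infimum of the lengths of all paths from $\alpha(t-r)$ to $\alpha(t+r)$ lying outside the open ball of radius $r$ about $\alpha(t)$ ($\infty$ if there are none). The lower divergence of $\alpha$ is $ldiv_\alpha(r)=\inf_{t\in\mathbb{R}}\rho_\alpha(r,t)$.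 The divergence spectrum $S_X$ of a space $X$ is the set of functions $f:[0,\infty)\to[0,\infty]$ such that $f\sim ldiv_\gamma$ for some Morse bi-infinite geodesic $\gamma$ in $X$. *)

theory Defs
  imports "HOL-Analysis.Analysis"
begin

text \<open>
  Functions \<open>[0, \<infinity>) \<rightarrow> [0, \<infinity>]\<close> are represented by \<^typ>\<open>real \<Rightarrow> ennreal\<close>. Only arguments
  \<open>x > D > 0\<close> enter the comparison, so values outside \<open>(0, \<infinity>)\<close> do not matter.
\<close>

definition preceq_fun :: "(real \<Rightarrow> ennreal) \<Rightarrow> (real \<Rightarrow> ennreal) \<Rightarrow> bool"
    (infix "\<preceq>\<^sub>d" 50) where
  "f \<preceq>\<^sub>d g \<longleftrightarrow>
    (\<exists>A>0. \<exists>B>0. \<exists>C>0. \<exists>D>0. \<forall>x>D. f x \<le> ennreal A * g (B * x) + ennreal (C * x))"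

definition sim_fun :: "(real \<Rightarrow> ennreal) \<Rightarrow> (real \<Rightarrow> ennreal) \<Rightarrow> bool"
    (infix "\<sim>\<^sub>d" 50) where
  "f \<sim>\<^sub>d g \<longleftrightarrow> f \<preceq>\<^sub>d g \<and> g \<preceq>\<^sub>d f"

text \<open>
  The usual convention \<open>K \<ge> 1\<close>, \<open>L \<ge> 0\<close> is part of the definition. It cannot be omitted: in HOL
  \<open>1 / 0 = 0\<close>, so \<open>K = 0\<close> would impose no lower bound growing with the distance.
\<close>

definition qi_embedding_on ::
    "real \<Rightarrow> real \<Rightarrow> 'a::metric_space set \<Rightarrow> ('a \<Rightarrow> 'b::metric_space) \<Rightarrow> bool" where
  "qi_embedding_on K L S \<Phi> \<longleftrightarrow> K \<ge> 1 \<and> L \<ge> 0 \<and>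
    (\<forall>x\<in>S. \<forall>y\<in>S. 1 / K * dist x y - L \<le> dist (\<Phi> x) (\<Phi> y) \<and>
                   dist (\<Phi> x) (\<Phi> y) \<le> K * dist x y + L)"

text \<open>
  Neighborhoods are closed here and below, so that \<open>L = 0\<close> is meaningful; since the constants are
  existentially quantified in every use, open neighborhoods give the same notions.
\<close>

definition quasi_isometry ::
    "real \<Rightarrow> real \<Rightarrow> ('a::metric_space \<Rightarrow> 'b::metric_space) \<Rightarrow> bool" where
  "quasi_isometry K L \<Phi> \<longleftrightarrow> qi_embedding_on K L UNIV \<Phi> \<and> (\<forall>y. \<exists>x. dist y (\<Phi> x) \<le> L)"

definition quasi_isometric :: "'a::metric_space itself \<Rightarrow> 'b::metric_space itself \<Rightarrow> bool" where
  "quasi_isometric X Y \<longleftrightarrow> (\<exists>K L. \<exists>\<Phi> :: 'a \<Rightarrow> 'b. quasi_isometry K L \<Phi>)"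

text \<open>Quasi-geodesics need not be continuous.\<close>

definition quasi_geodesic ::
    "real \<Rightarrow> real \<Rightarrow> real set \<Rightarrow> (real \<Rightarrow> 'a::metric_space) \<Rightarrow> bool" where
  "quasi_geodesic K L I \<gamma> \<longleftrightarrow> is_interval I \<and> qi_embedding_on K L I \<gamma>"

abbreviation geodesic :: "real set \<Rightarrow> (real \<Rightarrow> 'a::metric_space) \<Rightarrow> bool" where
  "geodesic \<equiv> quasi_geodesic 1 0"

definition proper_space :: "'a::metric_space itself \<Rightarrow> bool" where
  "proper_space X \<longleftrightarrow> (\<forall>(x::'a) r. compact (cball x r))"

definition geodesic_space :: "'a::metric_space itself \<Rightarrow> bool" where
  "geodesic_space X \<longleftrightarrow>
    (\<forall>x y :: 'a. \<exists>a b \<gamma>. a \<le> b \<and> geodesic {a..b} \<gamma> \<and> \<gamma> a = x \<and> \<gamma> b = y)"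

definition morse :: "real set \<Rightarrow> (real \<Rightarrow> 'a::metric_space) \<Rightarrow> bool" where
  "morse I \<gamma> \<longleftrightarrow>
    (\<forall>K\<ge>1. \<forall>L>0. \<exists>M. \<forall>a b \<sigma>.
       a \<le> b \<and> quasi_geodesic K L {a..b} \<sigma> \<and> \<sigma> a \<in> \<gamma> ` I \<and> \<sigma> b \<in> \<gamma> ` I \<longrightarrow>
       (\<forall>s\<in>{a..b}. \<exists>t\<in>I. dist (\<sigma> s) (\<gamma> t) \<le> M))"

text \<open>
  Length of a path on \<open>[0, 1]\<close>: the supremum over all partitions
  \<open>0 \<le> u 0 \<le> \<dots> \<le> u n \<le> 1\<close> of the length of the inscribed polygon.
\<close>

definition path_length :: "(real \<Rightarrow> 'a::metric_space) \<Rightarrow> ennreal" where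
  "path_length p =
    (SUP (n, u) \<in> {(n::nat, u::nat \<Rightarrow> real). mono_on {..n} u \<and> u ` {..n} \<subseteq> {0..1}}.
       \<Sum>i<n. ennreal (dist (p (u i)) (p (u (Suc i)))))"

text \<open>The infimum of the empty set in \<^typ>\<open>ennreal\<close> is \<open>\<infinity>\<close>.\<close>

definition rho :: "(real \<Rightarrow> 'a::metric_space) \<Rightarrow> real \<Rightarrow> real \<Rightarrow> ennreal" where
  "rho \<alpha> r t =
    (INF p \<in> {p. path p \<and> pathstart p = \<alpha> (t - r) \<and> pathfinish p = \<alpha> (t + r) \<and>
                 path_image p \<inter> ball (\<alpha> t) r = {}}. path_length p)"

definition ldiv :: "(real \<Rightarrow> 'a::metric_space) \<Rightarrow> real \<Rightarrow> ennreal" where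
  "ldiv \<alpha> r = (INF t. rho \<alpha> r t)"

text \<open>
  Members of the spectrum have domain \<open>[0, \<infinity>)\<close>, expressed by extensionality on \<open>{0..}\<close>.
\<close>

definition divergence_spectrum :: "'a::metric_space itself \<Rightarrow> (real \<Rightarrow> ennreal) set" where
  "divergence_spectrum X =
    {f \<in> {0..} \<rightarrow>\<^sub>E UNIV.
       \<exists>\<gamma> :: real \<Rightarrow> 'a. geodesic UNIV \<gamma> \<and> morse UNIV \<gamma> \<and> f \<sim>\<^sub>d ldiv \<gamma>}"

end

theory Submission
  imports Defs
begin

text \<open>
  Let \<open>\<Phi>\<close> be a quasi-isometry with coarse inverse \<open>\<Psi>\<close>. The image of a Morse geodesic \<open>\<gamma>\<close> under
  \<open>\<Phi>\<close> is a Morse quasi-geodesic, so the geodesic segments between its far points stay close to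
  it and pass near \<open>\<Phi> (\<gamma> 0)\<close>. By properness these segments have a limit, a bi-infinite geodesic
  \<open>\<gamma>'\<close> at finite Hausdorff distance from \<open>\<Phi> \<circ> \<gamma>\<close>, and \<open>\<gamma>'\<close> is again Morse. A path avoiding a
  ball about a point of \<open>\<gamma>\<close> is carried by \<open>\<Phi>\<close>, up to a bounded multiple of its length, to a path
  avoiding a comparable ball about a point of \<open>\<gamma>'\<close>, and \<open>\<Psi>\<close> does the same in the other direction;
  hence the lower divergences of \<open>\<gamma>\<close> and \<open>\<gamma>'\<close> are equivalent.
\<close>

section \<open>Quasi-isometric embeddings\<close>

lemma qi_embedding_onD:
  assumes "qi_embedding_on K L S f"
  shows "1 \<le> K" and "0 \<le> L"
    and "\<And>x y. x \<in> S \<Longrightarrow> y \<in> S \<Longrightarrow> dist (f x) (f y) \<le> K * dist x y + L"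
    and "\<And>x y. x \<in> S \<Longrightarrow> y \<in> S \<Longrightarrow> dist x y \<le> K * (dist (f x) (f y) + L)"
proof -
  show K: "1 \<le> K" and "0 \<le> L"
    and "\<And>x y. x \<in> S \<Longrightarrow> y \<in> S \<Longrightarrow> dist (f x) (f y) \<le> K * dist x y + L"
    using assms by (auto simp: qi_embedding_on_def)
  fix x y assume "x \<in> S" "y \<in> S"
  then have "1 / K * dist x y - L \<le> dist (f x) (f y)"
    using assms by (auto simp: qi_embedding_on_def)
  then have "1 / K * dist x y \<le> dist (f x) (f y) + L"
    by simp
  then show "dist x y \<le> K * (dist (f x) (f y) + L)"
    using K by (simp add: field_simps)
qed

lemma qi_embedding_onI:
  assumes "1 \<le> K" and "0 \<le> L"
    and "\<And>x y. x \<in> S \<Longrightarrow> y \<in> S \<Longrightarrow> dist (f x) (f y) \<le> K * dist x y + L"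
    and "\<And>x y. x \<in> S \<Longrightarrow> y \<in> S \<Longrightarrow> dist x y \<le> K * (dist (f x) (f y) + L)"
  shows "qi_embedding_on K L S f"
  using assms by (auto simp: qi_embedding_on_def field_simps)

lemma qi_embedding_on_dist_le:
  assumes "qi_embedding_on K L S f" and "x \<in> S" and "y \<in> S" and "dist x y \<le> c"
  shows "dist (f x) (f y) \<le> K * c + L"
proof -
  have "K * dist x y \<le> K * c"
    using qi_embedding_onD(1)[OF assms(1)] assms(4) by (intro mult_left_mono) auto
  then show ?thesis
    using qi_embedding_onD(3)[OF assms(1-3)] by simp
qed

lemma qi_embedding_on_subset:
  "qi_embedding_on K L S f \<Longrightarrow> T \<subseteq> S \<Longrightarrow> qi_embedding_on K L T f"
  unfolding qi_embedding_on_def by blast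

lemma qi_embedding_on_mono:
  assumes "qi_embedding_on K L S f" and "K \<le> K'" and "L \<le> L'"
  shows "qi_embedding_on K' L' S f"
proof (rule qi_embedding_onI)
  note f = qi_embedding_onD[OF assms(1)]
  show "1 \<le> K'" "0 \<le> L'"
    using f(1,2) assms by auto
  fix x y assume xy: "x \<in> S" "y \<in> S"
  have "K * dist x y \<le> K' * dist x y"
    using assms by (simp add: mult_right_mono)
  then show "dist (f x) (f y) \<le> K' * dist x y + L'"
    using f(3)[OF xy] assms by simp
  have "K * (dist (f x) (f y) + L) \<le> K' * (dist (f x) (f y) + L')"
    using f(1,2) assms by (intro mult_mono) auto
  then show "dist x y \<le> K' * (dist (f x) (f y) + L')"
    using f(4)[OF xy] by simp
qed

lemma qi_embedding_on_compose:
  assumes f: "qi_embedding_on K L S f" and g: "qi_embedding_on K' L' UNIV g"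
  shows "qi_embedding_on (K' * K) (K' * L + L') S (\<lambda>x. g (f x))"
proof (rule qi_embedding_onI)
  note F = qi_embedding_onD[OF f] and G = qi_embedding_onD[OF g]
  show "1 \<le> K' * K"
    using F(1) G(1) mult_mono[of 1 K' 1 K] by simp
  show "0 \<le> K' * L + L'"
    using F(2) G(1,2) by simp
  fix x y assume xy: "x \<in> S" "y \<in> S"
  have "dist (g (f x)) (g (f y)) \<le> K' * dist (f x) (f y) + L'"
    using G(3) by simp
  also have "\<dots> \<le> K' * (K * dist x y + L) + L'"
    using F(3)[OF xy] G(1) by (intro add_right_mono mult_left_mono) auto
  finally show "dist (g (f x)) (g (f y)) \<le> K' * K * dist x y + (K' * L + L')"
    by (simp add: algebra_simps)
  have "dist (f x) (f y) + L \<le> K' * (dist (g (f x)) (g (f y)) + L') + K' * L"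
    using G(4)[of "f x" "f y"] mult_right_mono[OF G(1) F(2)] by simp
  then have "K * (dist (f x) (f y) + L) \<le> K * (K' * (dist (g (f x)) (g (f y)) + L') + K' * L)"
    using F(1) by (intro mult_left_mono) auto
  then show "dist x y \<le> K' * K * (dist (g (f x)) (g (f y)) + (K' * L + L'))"
  proof -
    have "K * K' * L \<le> K * K' * (K' * L)"
      using F(1,2) G(1) mult_right_mono[OF G(1) F(2)] by (intro mult_left_mono) auto
    then show ?thesis
      using F(4)[OF xy] \<open>K * (dist (f x) (f y) + L) \<le> _\<close> by (simp add: algebra_simps)
  qed
qed

text \<open>This single lemma yields coarse inverses (\<open>f = id\<close>), perturbations of quasi-geodesics
  (\<open>g = id\<close>) and nearest-point reparametrizations (\<open>g\<close> a line).\<close>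

lemma qi_embedding_on_shadow:
  fixes f :: "'a::metric_space \<Rightarrow> 'c::metric_space" and g :: "'b::metric_space \<Rightarrow> 'c"
  assumes f: "qi_embedding_on K L S f" and g: "qi_embedding_on K' L' UNIV g"
    and C: "0 \<le> C" and close: "\<And>s. s \<in> S \<Longrightarrow> dist (f s) (g (h s)) \<le> C"
  shows "qi_embedding_on (K' * K) (K' * (L + L' + 2 * C)) S h"
proof (rule qi_embedding_onI)
  note F = qi_embedding_onD[OF f] and G = qi_embedding_onD[OF g]
  show "1 \<le> K' * K"
    using F(1) G(1) mult_mono[of 1 K' 1 K] by simp
  show "0 \<le> K' * (L + L' + 2 * C)"
    using F(2) G(1,2) C by simp
  fix x y assume xy: "x \<in> S" "y \<in> S"
  have close': "\<bar>dist (f x) (f y) - dist (g (h x)) (g (h y))\<bar> \<le> 2 * C"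
    using close[OF xy(1)] close[OF xy(2)]
      dist_triangle[of "f x" "f y" "g (h x)"] dist_triangle[of "g (h x)" "f y" "g (h y)"]
      dist_triangle[of "g (h x)" "g (h y)" "f x"] dist_triangle[of "f x" "g (h y)" "f y"]
    by (simp add: dist_commute)
  have "dist (h x) (h y) \<le> K' * (dist (g (h x)) (g (h y)) + L')"
    using G(4) by simp
  also have "\<dots> \<le> K' * (K * dist x y + L + 2 * C + L')"
    using F(3)[OF xy] G(1) close' by (intro mult_left_mono) auto
  finally show "dist (h x) (h y) \<le> K' * K * dist x y + K' * (L + L' + 2 * C)"
    by (simp add: algebra_simps)
  have "dist x y \<le> K * (dist (f x) (f y) + L)"
    using F(4)[OF xy] .
  also have "\<dots> \<le> K * (K' * dist (h x) (h y) + L' + 2 * C + L)"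
    using F(1) G(3)[of "h x" "h y"] close' by (intro mult_left_mono) auto
  also have "\<dots> \<le> K * (K' * (dist (h x) (h y) + K' * (L + L' + 2 * C)))"
  proof -
    have "1 * (L + L' + 2 * C) \<le> (K' * K') * (L + L' + 2 * C)"
      using F(2) G(1,2) C mult_mono[of 1 K' 1 K'] by (intro mult_right_mono) auto
    then show ?thesis
      using F(1) by (intro mult_left_mono) (auto simp: algebra_simps)
  qed
  finally show "dist x y \<le> K' * K * (dist (h x) (h y) + K' * (L + L' + 2 * C))"
    by (simp add: algebra_simps)
qed

lemma geodesic_iff:
  "geodesic I \<gamma> \<longleftrightarrow> is_interval I \<and> (\<forall>s\<in>I. \<forall>t\<in>I. dist (\<gamma> s) (\<gamma> t) = \<bar>s - t\<bar>)"
  by (force simp: quasi_geodesic_def qi_embedding_on_def dist_real_def)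

lemma geodesic_UNIV_dist: "geodesic UNIV \<gamma> \<Longrightarrow> dist (\<gamma> s) (\<gamma> t) = \<bar>s - t\<bar>"
  by (simp add: geodesic_iff)

lemma qi_embedding_on_id: "qi_embedding_on 1 0 S (\<lambda>x. x)"
  by (simp add: qi_embedding_on_def)

section \<open>Coarse geometry of the line\<close>

lemma coarse_ivt:
  fixes h :: "real \<Rightarrow> real"
  assumes jump: "\<And>s t. s \<in> {a..b} \<Longrightarrow> t \<in> {a..b} \<Longrightarrow> \<bar>s - t\<bar> \<le> 1 \<Longrightarrow> \<bar>h s - h t\<bar> \<le> J"
    and "a \<le> b" and "h a \<le> v" and "v \<le> h b"
  shows "\<exists>s\<in>{a..b}. \<bar>h s - v\<bar> \<le> J"
proof -
  define A where "A = {s\<in>{a..b}. h s \<le> v}"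
  have "a \<in> A" and bdd: "bdd_above A"
    using assms by (auto simp: A_def)
  then obtain s where s: "s \<in> A" "Sup A < s + 1"
    using less_cSup_iff[OF _ bdd, of "Sup A - 1"] by (force simp: diff_less_eq)
  define s' where "s' = min (s + 1) b"
  have "s' = b \<or> s' > Sup A"
    using s by (auto simp: s'_def)
  moreover have "s' \<in> {a..b}" "\<bar>s - s'\<bar> \<le> 1"
    using s by (auto simp: A_def s'_def)
  ultimately have "v \<le> h s'"
    using cSup_upper[OF _ bdd, of s'] assms by (force simp: A_def)
  then have "\<bar>h s - v\<bar> \<le> \<bar>h s - h s'\<bar>"
    using s by (auto simp: A_def)
  then show ?thesis
    using jump[of s s'] \<open>s' \<in> {a..b}\<close> \<open>\<bar>s - s'\<bar> \<le> 1\<close> s by (force simp: A_def)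
qed

lemma qi_embedding_ivt:
  fixes h :: "real \<Rightarrow> real"
  assumes h: "qi_embedding_on K L {a..b} h" and "a \<le> b"
    and v: "h a \<le> v \<and> v \<le> h b \<or> h b \<le> v \<and> v \<le> h a"
  shows "\<exists>s\<in>{a..b}. \<bar>h s - v\<bar> \<le> K + L"
proof -
  note H = qi_embedding_onD[OF h]
  have jump: "\<bar>h s - h t\<bar> \<le> K + L"
    if "s \<in> {a..b}" "t \<in> {a..b}" "\<bar>s - t\<bar> \<le> 1" for s t
    using qi_embedding_on_dist_le[OF h that(1,2), of 1] that(3) by (simp add: dist_real_def)
  from v show ?thesis
  proof
    assume "h a \<le> v \<and> v \<le> h b"
    then show ?thesis
      using coarse_ivt[of a b h "K + L" v] jump \<open>a \<le> b\<close> by blast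
  next
    assume "h b \<le> v \<and> v \<le> h a"
    then have "\<exists>s\<in>{a..b}. \<bar>- h s - (- v)\<bar> \<le> K + L"
      using jump \<open>a \<le> b\<close> by (intro coarse_ivt) (force simp: abs_minus_commute)+
    then show ?thesis
      by (force simp: abs_minus_commute)
  qed
qed

text \<open>If \<open>h b\<close> were extremal, then \<open>h\<close> would nearly take the value \<open>h a\<close> beyond \<open>b\<close> or the value
  \<open>h c\<close> before \<open>b\<close>.\<close>

lemma qi_embedding_between:
  fixes h :: "real \<Rightarrow> real"
  assumes h: "qi_embedding_on K L UNIV h"
    and ab: "K * (K + 2 * L) < b - a" and bc: "K * (K + 2 * L) < c - b"
  shows "h a < h b \<and> h b < h c \<or> h c < h b \<and> h b < h a"
proof (rule ccontr)
  assume neg: "\<not> ?thesis"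
  note H = qi_embedding_onD[OF h]
  have "0 \<le> K * (K + 2 * L)"
    using H(1,2) by simp
  then have "a \<le> b" "b \<le> c"
    using ab bc by auto
  have far: "\<not> \<bar>h s - h u\<bar> \<le> K + L" if "K * (K + 2 * L) < \<bar>s - u\<bar>" for s u
  proof
    assume "\<bar>h s - h u\<bar> \<le> K + L"
    then have "K * (\<bar>h s - h u\<bar> + L) \<le> K * (K + 2 * L)"
      using H(1) by (intro mult_left_mono) auto
    then show False
      using H(4)[of s u] that by (simp add: dist_real_def)
  qed
  have "(h a \<le> h c \<and> h c \<le> h b \<or> h b \<le> h c \<and> h c \<le> h a) \<or>
        (h b \<le> h a \<and> h a \<le> h c \<or> h c \<le> h a \<and> h a \<le> h b)"
    using neg by linarith
  then show False
  proof
    assume "h a \<le> h c \<and> h c \<le> h b \<or> h b \<le> h c \<and> h c \<le> h a"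
    then obtain s where "s \<in> {a..b}" "\<bar>h s - h c\<bar> \<le> K + L"
      using qi_embedding_ivt[OF qi_embedding_on_subset[OF h] \<open>a \<le> b\<close>] by blast
    then show False
      using far[of s c] bc by fastforce
  next
    assume "h b \<le> h a \<and> h a \<le> h c \<or> h c \<le> h a \<and> h a \<le> h b"
    then obtain s where "s \<in> {b..c}" "\<bar>h s - h a\<bar> \<le> K + L"
      using qi_embedding_ivt[OF qi_embedding_on_subset[OF h] \<open>b \<le> c\<close>] by blast
    then show False
      using far[of s a] ab by fastforce
  qed
qed

lemma qi_embedding_real_coarsely_surj:
  fixes h :: "real \<Rightarrow> real"
  assumes h: "qi_embedding_on K L UNIV h"
  shows "\<exists>s. \<bar>h s - v\<bar> \<le> K + L"
proof -
  note H = qi_embedding_onD[OF h]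
  define n where "n = K * (\<bar>h 0 - v\<bar> + L) + K * (K + 2 * L) + 1"
  have n: "K * (K + 2 * L) < n" "K * (\<bar>h 0 - v\<bar> + L) \<le> n" "0 \<le> n"
    using H(1,2) by (auto simp: n_def intro!: add_nonneg_pos add_nonneg_nonneg mult_nonneg_nonneg)
  have far: "\<bar>h 0 - v\<bar> \<le> \<bar>h s - h 0\<bar>" if "\<bar>s\<bar> = n" for s
  proof -
    have "K * (\<bar>h 0 - v\<bar> + L) \<le> K * (\<bar>h s - h 0\<bar> + L)"
      using H(4)[of s 0] n that by (simp add: dist_real_def)
    then show ?thesis
      using H(1) by simp
  qed
  have "h (-n) < h 0 \<and> h 0 < h n \<or> h n < h 0 \<and> h 0 < h (-n)"
    using qi_embedding_between[OF h, of 0 "-n" n] n by simp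
  then have "h (-n) \<le> v \<and> v \<le> h n \<or> h n \<le> v \<and> v \<le> h (-n)"
    using far[of n] far[of "-n"] n(3) by (auto simp: abs_if split: if_splits)
  then show ?thesis
    using qi_embedding_ivt[OF qi_embedding_on_subset[OF h], of "-n" n v] n(3) by auto
qed

section \<open>Bi-infinite geodesics as limits of segments\<close>

lemma geodesic_line_limit:
  fixes y :: "'a::metric_space"
  assumes proper: "proper_space TYPE('a)" and T: "closed T"
    and segments: "\<And>m::nat. \<exists>\<sigma>. geodesic {-real m..real m} \<sigma> \<and> \<sigma> ` {-real m..real m} \<subseteq> T \<and>
                             dist y (\<sigma> 0) \<le> C"
  shows "\<exists>\<gamma>. geodesic UNIV \<gamma> \<and> range \<gamma> \<subseteq> T"
proof -
  define P where "P = (\<Pi>\<^sub>E t\<in>(UNIV :: real set). cball y (\<bar>t\<bar> + C))"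
  define I where "I m = {-real m..real m}" for m
  define F where "F m = {\<sigma>. (\<forall>s\<in>I m. \<forall>t\<in>I m. dist (\<sigma> s) (\<sigma> t) = \<bar>s - t\<bar>) \<and> (\<forall>s\<in>I m. \<sigma> s \<in> T)}"
    for m
  have cont: "continuous_on UNIV (\<lambda>\<sigma>. \<sigma> s)" for s :: real
    by (rule continuous_on_product_coordinates)
  have "compact P"
    using proper unfolding P_def proper_space_def
    by (simp flip: compactin_euclidean_iff add: euclidean_product_topology[symmetric] compactin_PiE)
  moreover have "closed (F m)" for m
  proof -
    have "F m = (\<Inter>s\<in>I m. \<Inter>t\<in>I m. {\<sigma>. dist (\<sigma> s) (\<sigma> t) = \<bar>s - t\<bar>}) \<inter> (\<Inter>s\<in>I m. (\<lambda>\<sigma>. \<sigma> s) -` T)"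
      by (auto simp: F_def)
    then show ?thesis
      using T by (auto intro!: closed_Int closed_INT closed_Collect_eq closed_vimage cont
          continuous_on_dist continuous_on_const simp: continuous_on_eq_continuous_at[symmetric])
  qed
  moreover have "P \<inter> (\<Inter>m\<in>M. F m) \<noteq> {}" if "finite M" for M
  proof -
    obtain k where k: "M \<subseteq> {..k}"
      using \<open>finite M\<close> finite_nat_iff_bounded_le by auto
    from segments[of k] obtain \<sigma> where \<sigma>: "\<And>s t. s \<in> I k \<Longrightarrow> t \<in> I k \<Longrightarrow> dist (\<sigma> s) (\<sigma> t) = \<bar>s - t\<bar>"
        "\<And>s. s \<in> I k \<Longrightarrow> \<sigma> s \<in> T" "dist y (\<sigma> 0) \<le> C"
      unfolding geodesic_iff I_def by (metis image_subset_iff)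
    define \<sigma>' where "\<sigma>' t = (if t \<in> I k then \<sigma> t else y)" for t
    have "0 \<le> C"
      using \<sigma>(3) zero_le_dist order_trans by blast
    have "dist y (\<sigma> t) \<le> \<bar>t\<bar> + C" if "t \<in> I k" for t
      using dist_triangle[of y "\<sigma> t" "\<sigma> 0"] \<sigma>(1)[OF _ that, of 0] \<sigma>(3) by (simp add: I_def)
    then have "\<sigma>' \<in> P"
      using \<open>0 \<le> C\<close> by (auto simp: P_def \<sigma>'_def)
    moreover have "I m \<subseteq> I k" if "m \<in> M" for m
      using k that by (auto simp: I_def)
    then have "\<sigma>' \<in> F m" if "m \<in> M" for m
      using \<sigma>(1,2) that by (simp add: F_def \<sigma>'_def subset_iff)
    ultimately show ?thesis
      by auto
  qed
  ultimately have "P \<inter> (\<Inter>m\<in>UNIV. F m) \<noteq> {}"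
    using compact_imp_fip_image[of P UNIV F] by auto
  then obtain \<gamma> where \<gamma>: "\<And>m. \<gamma> \<in> F m"
    by auto
  have "\<exists>m. s \<in> I m \<and> t \<in> I m" for s t
  proof -
    obtain m where "max \<bar>s\<bar> \<bar>t\<bar> \<le> real m"
      using real_arch_simple by blast
    then show ?thesis
      by (intro exI[of _ m]) (auto simp: I_def)
  qed
  then have "dist (\<gamma> s) (\<gamma> t) = \<bar>s - t\<bar> \<and> \<gamma> s \<in> T" for s t
    using \<gamma> by (fastforce simp: F_def)
  then show ?thesis
    by (auto simp: geodesic_iff is_interval_univ)
qed

section \<open>Morse lines\<close>

lemma morse_transfer:
  fixes \<gamma> :: "real \<Rightarrow> 'a::metric_space" and \<delta> :: "real \<Rightarrow> 'b::metric_space" and \<Psi> :: "'b \<Rightarrow> 'a"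
  assumes \<Psi>: "qi_embedding_on K L UNIV \<Psi>" and \<gamma>: "morse UNIV \<gamma>" and "0 \<le> C"
    and close: "\<And>t. \<exists>t'. dist (\<Psi> (\<delta> t)) (\<gamma> t') \<le> C"
    and close': "\<And>t. \<exists>t'. dist (\<gamma> t) (\<Psi> (\<delta> t')) \<le> C"
  shows "morse UNIV \<delta>"
  unfolding morse_def
proof (intro allI impI)
  fix k l :: real assume kl: "1 \<le> k" "0 < l"
  note P = qi_embedding_onD[OF \<Psi>]
  define k' l' where "k' = K * k" and "l' = K * l + L + 2 * C"
  have "1 \<le> k'" "0 < l'"
    using kl P(1,2) \<open>0 \<le> C\<close> mult_mono[of 1 K 1 k]
    by (auto simp: k'_def l'_def intro!: add_pos_nonneg)
  then obtain M where M: "\<And>a b \<sigma> s. \<lbrakk>a \<le> b; quasi_geodesic k' l' {a..b} \<sigma>; \<sigma> a \<in> range \<gamma>;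
      \<sigma> b \<in> range \<gamma>; s \<in> {a..b}\<rbrakk> \<Longrightarrow> \<exists>t. dist (\<sigma> s) (\<gamma> t) \<le> M"
    using \<gamma> unfolding morse_def by (metis UNIV_I)
  have "\<exists>t. dist (\<sigma> s) (\<delta> t) \<le> K * (M + 2 * C + L)"
    if ab: "a \<le> b" and \<sigma>: "quasi_geodesic k l {a..b} \<sigma>" and ends: "\<sigma> a \<in> range \<delta>" "\<sigma> b \<in> range \<delta>"
      and s: "s \<in> {a..b}" for a b \<sigma> s
  proof -
    obtain p q where pq: "dist (\<Psi> (\<sigma> a)) (\<gamma> p) \<le> C" "dist (\<Psi> (\<sigma> b)) (\<gamma> q) \<le> C"
      using ends close by (metis rangeE)
    define \<tau> where "\<tau> u = (if u = a then \<gamma> p else if u = b then \<gamma> q else \<Psi> (\<sigma> u))" for u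
    have near: "dist (\<Psi> (\<sigma> u)) (\<tau> u) \<le> C" for u
      using pq \<open>0 \<le> C\<close> by (auto simp: \<tau>_def)
    have "qi_embedding_on (K * k) (K * l + L) {a..b} (\<lambda>u. \<Psi> (\<sigma> u))"
      using \<sigma> qi_embedding_on_compose[OF _ \<Psi>] by (auto simp: quasi_geodesic_def)
    then have "qi_embedding_on (1 * (K * k)) (1 * (K * l + L + 0 + 2 * C)) {a..b} \<tau>"
      by (rule qi_embedding_on_shadow[OF _ qi_embedding_on_id \<open>0 \<le> C\<close>]) (rule near)
    then have "quasi_geodesic k' l' {a..b} \<tau>"
      by (simp add: quasi_geodesic_def k'_def l'_def is_interval_cc)
    moreover have "\<tau> a \<in> range \<gamma>" "\<tau> b \<in> range \<gamma>"
      by (auto simp: \<tau>_def)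
    ultimately obtain t where t: "dist (\<tau> s) (\<gamma> t) \<le> M"
      using M ab s by blast
    obtain t' where t': "dist (\<gamma> t) (\<Psi> (\<delta> t')) \<le> C"
      using close' by blast
    have "dist (\<Psi> (\<sigma> s)) (\<Psi> (\<delta> t')) \<le> M + 2 * C"
      using near[of s] t t' dist_triangle[of "\<Psi> (\<sigma> s)" "\<Psi> (\<delta> t')" "\<tau> s"]
        dist_triangle[of "\<tau> s" "\<Psi> (\<delta> t')" "\<gamma> t"] by simp
    then have "K * (dist (\<Psi> (\<sigma> s)) (\<Psi> (\<delta> t')) + L) \<le> K * (M + 2 * C + L)"
      using P(1) by (intro mult_left_mono) auto
    then show ?thesis
      using P(4)[of "\<sigma> s" "\<delta> t'"] by (auto intro: order_trans)
  qed
  then show "\<exists>M. \<forall>a b \<sigma>. a \<le> b \<and> quasi_geodesic k l {a..b} \<sigma> \<and> \<sigma> a \<in> range \<delta> \<and> \<sigma> b \<in> range \<delta> \<longrightarrow>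
      (\<forall>s\<in>{a..b}. \<exists>t\<in>UNIV. dist (\<sigma> s) (\<delta> t) \<le> M)"
    by blast
qed

lemma morse_quasi_line_shadowed_by_geodesic:
  fixes \<delta> :: "real \<Rightarrow> 'a::metric_space"
  assumes proper: "proper_space TYPE('a)" and geod: "geodesic_space TYPE('a)"
    and \<delta>: "qi_embedding_on K L UNIV \<delta>" and "morse UNIV \<delta>"
  shows "\<exists>\<gamma> M. geodesic UNIV \<gamma> \<and> 0 \<le> M \<and> (\<forall>s. \<exists>t. dist (\<gamma> s) (\<delta> t) \<le> M)"
proof -
  note D = qi_embedding_onD[OF \<delta>]
  obtain M where M: "\<And>a b \<sigma> s. \<lbrakk>a \<le> b; quasi_geodesic 1 1 {a..b} \<sigma>; \<sigma> a \<in> range \<delta>;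
      \<sigma> b \<in> range \<delta>; s \<in> {a..b}\<rbrakk> \<Longrightarrow> \<exists>t. dist (\<sigma> s) (\<delta> t) \<le> M"
    using \<open>morse UNIV \<delta>\<close> unfolding morse_def by (metis UNIV_I order_refl zero_less_one)
  define J where "J = K + K * (L + 2 * \<bar>M\<bar>)"
  define C where "C = \<bar>M\<bar> + K * J + L"
  define T where "T = {y. infdist y (range \<delta>) \<le> \<bar>M\<bar>}"
  have "closed T"
    unfolding T_def by (intro closed_Collect_le continuous_intros)
  moreover have "\<exists>\<sigma>. geodesic {-real m..real m} \<sigma> \<and> \<sigma> ` {-real m..real m} \<subseteq> T \<and>
      dist (\<delta> 0) (\<sigma> 0) \<le> C" for m
  proof -
    define n where "n = K * (real m + C + L)"
    have "0 < J"
      using D(1,2) by (simp add: J_def add_pos_nonneg)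
    then have "0 < C"
      using D(1,2) by (simp add: C_def add_pos_nonneg add_nonneg_pos)
    have "0 \<le> n"
      using D(1,2) \<open>0 < C\<close> by (simp add: n_def)
    obtain a b \<sigma> where ab: "a \<le> b" and \<sigma>: "geodesic {a..b} \<sigma>" "\<sigma> a = \<delta> (-n)" "\<sigma> b = \<delta> n"
      using geod unfolding geodesic_space_def by metis
    have dist_\<sigma>: "dist (\<sigma> s) (\<sigma> t) = \<bar>s - t\<bar>" if "s \<in> {a..b}" "t \<in> {a..b}" for s t
      using \<sigma>(1) that unfolding geodesic_iff by blast
    have qi\<sigma>: "qi_embedding_on 1 0 {a..b} \<sigma>"
      using \<sigma>(1) by (simp add: quasi_geodesic_def)
    then have "quasi_geodesic 1 1 {a..b} \<sigma>"
      by (auto simp: quasi_geodesic_def is_interval_cc intro: qi_embedding_on_mono)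
    then have "\<exists>t. dist (\<sigma> s) (\<delta> t) \<le> \<bar>M\<bar>" if "s \<in> {a..b}" for s
      using M[OF ab, of \<sigma> s] \<sigma>(2,3) that by (metis abs_ge_self order_trans rangeI)
    then obtain \<tau>0 where \<tau>0: "\<And>s. s \<in> {a..b} \<Longrightarrow> dist (\<sigma> s) (\<delta> (\<tau>0 s)) \<le> \<bar>M\<bar>"
      by metis
    obtain s0 where s0: "s0 \<in> {a..b}" "dist (\<sigma> s0) (\<delta> 0) \<le> C"
    proof -
      have "a \<noteq> b"
      proof
        assume "a = b"
        then have "\<delta> (-n) = \<delta> n"
          using \<sigma> by simp
        then have "n + n \<le> K * L"
          using D(4)[of "-n" n] \<open>0 \<le> n\<close> by (simp add: dist_real_def)
        moreover have "K * L + K * C \<le> n"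
          using D(1) by (simp add: n_def algebra_simps)
        moreover have "0 < K * C"
          using D(1) \<open>0 < C\<close> by simp
        ultimately show False
          using \<open>0 \<le> n\<close> by simp
      qed
      define \<tau> where "\<tau> s = (if s = a then -n else if s = b then n else \<tau>0 s)" for s
      have \<tau>: "dist (\<sigma> s) (\<delta> (\<tau> s)) \<le> \<bar>M\<bar>" if "s \<in> {a..b}" for s
        using \<tau>0 \<sigma> that by (simp add: \<tau>_def)
      have "qi_embedding_on (K * 1) (K * (0 + L + 2 * \<bar>M\<bar>)) {a..b} \<tau>"
        by (rule qi_embedding_on_shadow[OF qi\<sigma> \<delta>]) (use \<tau> in auto)
      moreover have "\<tau> a \<le> 0 \<and> 0 \<le> \<tau> b"
        using \<open>a \<noteq> b\<close> \<open>0 \<le> n\<close> by (simp add: \<tau>_def)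
      ultimately have "\<exists>s\<in>{a..b}. \<bar>\<tau> s - 0\<bar> \<le> K * 1 + K * (0 + L + 2 * \<bar>M\<bar>)"
        using qi_embedding_ivt[OF _ ab] by blast
      then obtain s where s: "s \<in> {a..b}" "\<bar>\<tau> s\<bar> \<le> J"
        by (auto simp: J_def)
      have "dist (\<delta> (\<tau> s)) (\<delta> 0) \<le> K * J + L"
        using s(2) by (intro qi_embedding_on_dist_le[OF \<delta>]) (auto simp: dist_real_def)
      then have "dist (\<sigma> s) (\<delta> 0) \<le> C"
        using dist_triangle[of "\<sigma> s" "\<delta> 0" "\<delta> (\<tau> s)"] \<tau>[OF s(1)] by (simp add: C_def)
      then show ?thesis
        using that s by blast
    qed
    have far: "real m \<le> \<bar>s0 - u\<bar>" if "u \<in> {a..b}" "\<sigma> u = \<delta> v" "\<bar>v\<bar> = n" for u v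
    proof -
      have "K * (real m + C + L) \<le> K * (dist (\<delta> 0) (\<delta> v) + L)"
        using D(4)[of 0 v] that by (simp add: dist_real_def n_def)
      then have "real m + C \<le> dist (\<delta> 0) (\<delta> v)"
        using D(1) by simp
      then show ?thesis
        using dist_triangle[of "\<delta> 0" "\<delta> v" "\<sigma> s0"] s0 dist_\<sigma>[OF s0(1) that(1)] that
        by (simp add: dist_commute)
    qed
    have "a \<le> s0 - real m" "s0 + real m \<le> b"
      using far[of a "-n"] far[of b n] \<sigma> s0(1) ab \<open>0 \<le> n\<close> by auto
    then have sub: "s0 + u \<in> {a..b}" if "u \<in> {-real m..real m}" for u
      using that by auto
    show ?thesis
    proof (intro exI[of _ "\<lambda>u. \<sigma> (s0 + u)"] conjI)
      show "geodesic {-real m..real m} (\<lambda>u. \<sigma> (s0 + u))"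
        using dist_\<sigma> sub by (simp add: geodesic_iff is_interval_cc)
      have "\<sigma> s \<in> T" if "s \<in> {a..b}" for s
        using infdist_le2[of "\<delta> (\<tau>0 s)" "range \<delta>" "\<sigma> s" "\<bar>M\<bar>"] \<tau>0[OF that] by (simp add: T_def)
      then show "(\<lambda>u. \<sigma> (s0 + u)) ` {-real m..real m} \<subseteq> T"
        using sub by blast
      show "dist (\<delta> 0) (\<sigma> (s0 + 0)) \<le> C"
        using s0 by (simp add: dist_commute)
    qed
  qed
  ultimately obtain \<gamma> where \<gamma>: "geodesic UNIV \<gamma>" "range \<gamma> \<subseteq> T"
    using geodesic_line_limit[OF proper, of T "\<delta> 0" C] by blast
  have "\<exists>t. dist (\<gamma> s) (\<delta> t) \<le> \<bar>M\<bar> + 1" for s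
  proof -
    have "infdist (\<gamma> s) (range \<delta>) < \<bar>M\<bar> + 1"
      using \<gamma>(2) by (auto simp: T_def image_subset_iff intro: le_less_trans)
    then show ?thesis
      using cINF_less_iff[of "range \<delta>" "dist (\<gamma> s)" "\<bar>M\<bar> + 1"]
      by (force simp: infdist_notempty intro: less_imp_le)
  qed
  then show ?thesis
    using \<gamma>(1) by (intro exI[of _ \<gamma>] exI[of _ "\<bar>M\<bar> + 1"]) auto
qed

section \<open>Lengths of paths\<close>

lemma path_length_leI:
  assumes "\<And>n u. mono_on {..n} u \<Longrightarrow> u ` {..n} \<subseteq> {0..1} \<Longrightarrow>
             (\<Sum>i<n. ennreal (dist (p (u i)) (p (u (Suc i))))) \<le> l"
  shows "path_length p \<le> l"
  unfolding path_length_def using assms by (auto intro!: SUP_least)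

lemma path_length_ge:
  assumes "mono_on {..n} u" and "u ` {..n} \<subseteq> {0..1}"
  shows "(\<Sum>i<n. ennreal (dist (p (u i)) (p (u (Suc i))))) \<le> path_length p"
  unfolding path_length_def using assms by (intro SUP_upper2[of "(n, u)"]) auto

lemma path_length_join:
  assumes "pathfinish p = pathstart q"
  shows "path_length (p +++ q) \<le> path_length p + path_length q"
proof (rule path_length_leI)
  fix n :: nat and u :: "nat \<Rightarrow> real"
  assume mono: "mono_on {..n} u" and u01: "u ` {..n} \<subseteq> {0..1}"
  let ?d = "\<lambda>g v w. ennreal (dist (g v) (g w))"
  define v w where "v i = (if u i \<le> 1/2 then 2 * u i else 1)"
    and "w i = (if u i \<le> 1/2 then 0 else 2 * u i - 1)" for i
  have step: "u i \<le> u (Suc i)" if "i < n" for i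
    using mono that by (auto simp: mono_on_def)
  have split: "?d (p +++ q) (u i) (u (Suc i)) \<le> ?d p (v i) (v (Suc i)) + ?d q (w i) (w (Suc i))"
    if "i < n" for i
  proof -
    consider "u (Suc i) \<le> 1/2" | "u i \<le> 1/2" "1/2 < u (Suc i)" | "1/2 < u i"
      by linarith
    then show ?thesis
    proof cases
      case 2
      have "dist (p (2 * u i)) (q (2 * u (Suc i) - 1)) \<le> dist (p (2 * u i)) (p 1) + dist (q 0) (q (2 * u (Suc i) - 1))"
        using assms dist_triangle[of "p (2 * u i)" "q (2 * u (Suc i) - 1)" "p 1"]
        by (simp add: pathstart_def pathfinish_def)
      then show ?thesis
        using 2 by (simp add: joinpaths_def v_def w_def ennreal_leI flip: ennreal_plus)
    qed (use step[OF that] in \<open>auto simp: joinpaths_def v_def w_def\<close>)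
  qed
  have "(\<Sum>i<n. ?d (p +++ q) (u i) (u (Suc i))) \<le>
        (\<Sum>i<n. ?d p (v i) (v (Suc i))) + (\<Sum>i<n. ?d q (w i) (w (Suc i)))"
    unfolding sum.distrib[symmetric] using split by (intro sum_mono) simp
  also have "\<dots> \<le> path_length p + path_length q"
  proof (intro add_mono path_length_ge)
    show "mono_on {..n} v" "mono_on {..n} w"
      using mono by (force simp: mono_on_def v_def w_def)+
    show "v ` {..n} \<subseteq> {0..1}" "w ` {..n} \<subseteq> {0..1}"
      using u01 by (auto simp: v_def w_def image_subset_iff)
  qed
  finally show "(\<Sum>i<n. ?d (p +++ q) (u i) (u (Suc i))) \<le> path_length p + path_length q" .
qed

lemma path_length_reversepath: "path_length (reversepath p) \<le> path_length p"
proof (rule path_length_leI)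
  fix n :: nat and u :: "nat \<Rightarrow> real"
  assume mono: "mono_on {..n} u" and u01: "u ` {..n} \<subseteq> {0..1}"
  define v where "v i = 1 - u (n - i)" for i
  have "(\<Sum>i<n. ennreal (dist (reversepath p (u i)) (reversepath p (u (Suc i))))) =
        (\<Sum>i<n. ennreal (dist (p (1 - u (n - Suc i))) (p (1 - u (Suc (n - Suc i))))))"
    by (simp add: reversepath_def
        sum.nat_diff_reindex[where g = "\<lambda>i. ennreal (dist (p (1 - u i)) (p (1 - u (Suc i))))"])
  also have "\<dots> = (\<Sum>i<n. ennreal (dist (p (v i)) (p (v (Suc i)))))"
    by (intro sum.cong) (simp_all add: v_def Suc_diff_Suc dist_commute)
  also have "\<dots> \<le> path_length p"
  proof (rule path_length_ge)
    show "mono_on {..n} v"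
      using mono by (auto simp: mono_on_def v_def)
    show "v ` {..n} \<subseteq> {0..1}"
      using u01 by (auto simp: v_def image_subset_iff)
  qed
  finally show "(\<Sum>i<n. ennreal (dist (reversepath p (u i)) (reversepath p (u (Suc i))))) \<le> path_length p" .
qed

lemma path_length_lipschitz:
  assumes "c-lipschitz_on {0..1} p"
  shows "path_length p \<le> ennreal c"
proof (rule path_length_leI)
  fix n :: nat and u :: "nat \<Rightarrow> real"
  assume mono: "mono_on {..n} u" and u01: "u ` {..n} \<subseteq> {0..1}"
  have "0 \<le> c"
    using assms by (rule lipschitz_on_nonneg)
  have "dist (p (u i)) (p (u (Suc i))) \<le> c * (u (Suc i) - u i)" if "i < n" for i
  proof -
    have "u i \<le> u (Suc i)" "u i \<in> {0..1}" "u (Suc i) \<in> {0..1}"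
      using that mono u01 by (auto simp: mono_on_def image_subset_iff)
    then show ?thesis
      using lipschitz_onD[OF assms, of "u i" "u (Suc i)"] by (simp add: dist_real_def)
  qed
  then have "(\<Sum>i<n. dist (p (u i)) (p (u (Suc i)))) \<le> c * (\<Sum>i<n. u (Suc i) - u i)"
    unfolding sum_distrib_left by (intro sum_mono) simp
  also have "\<dots> = c * (u n - u 0)"
    by (simp add: sum_lessThan_telescope)
  also have "\<dots> \<le> c"
  proof -
    have "u n \<le> 1" "0 \<le> u 0"
      using u01 by (auto simp: image_subset_iff)
    then show ?thesis
      using mult_left_mono[of "u n - u 0" 1 c] \<open>0 \<le> c\<close> by simp
  qed
  finally show "(\<Sum>i<n. ennreal (dist (p (u i)) (p (u (Suc i))))) \<le> ennreal c"
    by (simp add: ennreal_leI)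
qed

definition joinable :: "'a::metric_space set \<Rightarrow> real \<Rightarrow> 'a \<Rightarrow> 'a \<Rightarrow> bool" where
  "joinable S l x y \<longleftrightarrow> 0 \<le> l \<and> (\<exists>p. path p \<and> pathstart p = x \<and> pathfinish p = y \<and>
     path_image p \<subseteq> S \<and> path_length p \<le> ennreal l)"

lemma joinable_trans:
  assumes "joinable S l x y" and "joinable S m y z"
  shows "joinable S (l + m) x z"
proof -
  obtain p q where p: "path p" "pathstart p = x" "pathfinish p = y" "path_image p \<subseteq> S"
      "path_length p \<le> ennreal l"
    and q: "path q" "pathstart q = y" "pathfinish q = z" "path_image q \<subseteq> S"
      "path_length q \<le> ennreal m" and lm: "0 \<le> l" "0 \<le> m"
    using assms by (auto simp: joinable_def)
  have "path_length (p +++ q) \<le> path_length p + path_length q"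
    using p q by (simp add: path_length_join)
  also have "\<dots> \<le> ennreal (l + m)"
    using p q lm by (simp add: add_mono)
  finally show ?thesis
    using p q lm unfolding joinable_def
    by (intro conjI exI[of _ "p +++ q"]) (auto simp: path_image_join)
qed

lemma joinable_sym:
  assumes "joinable S l x y"
  shows "joinable S l y x"
proof -
  obtain p where p: "path p" "pathstart p = x" "pathfinish p = y" "path_image p \<subseteq> S"
      "path_length p \<le> ennreal l" and "0 \<le> l"
    using assms by (auto simp: joinable_def)
  then show ?thesis
    using order_trans[OF path_length_reversepath p(5)] unfolding joinable_def
    by (intro conjI exI[of _ "reversepath p"]) auto
qed

lemma joinable_mono:
  assumes "joinable S l x y" and "S \<subseteq> T" and "l \<le> m"
  shows "joinable T m x y"
proof -
  obtain p where "path p" "pathstart p = x" "pathfinish p = y" "path_image p \<subseteq> S"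
      "path_length p \<le> ennreal l" and "0 \<le> l"
    using assms(1) by (auto simp: joinable_def)
  then show ?thesis
    using assms(2,3) order_trans[OF \<open>path_length p \<le> ennreal l\<close> ennreal_leI[OF assms(3)]]
    unfolding joinable_def by (intro conjI exI[of _ p]) auto
qed

lemma joinable_geodesic_segment:
  assumes "a \<le> b" and \<sigma>: "geodesic {a..b} \<sigma>"
  shows "joinable (\<sigma> ` {a..b}) (b - a) (\<sigma> a) (\<sigma> b)"
proof -
  define p where "p v = \<sigma> (a + (b - a) * v)" for v
  have inside: "a + (b - a) * v \<in> {a..b}" if "v \<in> {0..1}" for v
    using that \<open>a \<le> b\<close> mult_left_mono[of v 1 "b - a"] by auto
  have lip: "(b - a)-lipschitz_on {0..1} p"
  proof (rule lipschitz_onI)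
    fix v w :: real assume vw: "v \<in> {0..1}" "w \<in> {0..1}"
    have "dist (p v) (p w) = \<bar>(b - a) * (v - w)\<bar>"
      using \<sigma> inside[OF vw(1)] inside[OF vw(2)] unfolding geodesic_iff p_def
      by (simp add: algebra_simps)
    then show "dist (p v) (p w) \<le> (b - a) * dist v w"
      using \<open>a \<le> b\<close> by (simp add: abs_mult dist_real_def)
  qed (use \<open>a \<le> b\<close> in simp)
  show ?thesis
    unfolding joinable_def
  proof (intro conjI exI[of _ p])
    show "path p"
      unfolding path_def using lip by (rule lipschitz_on_continuous_on)
    show "path_image p \<subseteq> \<sigma> ` {a..b}"
      unfolding path_image_def p_def using inside by blast
    show "path_length p \<le> ennreal (b - a)"
      using lip by (rule path_length_lipschitz)
  qed (use \<open>a \<le> b\<close> in \<open>auto simp: p_def pathstart_def pathfinish_def\<close>)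
qed

lemma joinable_geodesic_line:
  assumes \<gamma>: "geodesic UNIV \<gamma>"
  shows "joinable (\<gamma> ` closed_segment s t) \<bar>s - t\<bar> (\<gamma> s) (\<gamma> t)"
proof -
  have *: "joinable (\<gamma> ` {a..b}) (b - a) (\<gamma> a) (\<gamma> b)" if "a \<le> b" for a b
    using that \<gamma> by (intro joinable_geodesic_segment) (auto simp: geodesic_iff is_interval_cc)
  show ?thesis
    using *[of s t] joinable_sym[OF *[of t s]]
    by (cases "s \<le> t") (auto simp: closed_segment_eq_real_ivl)
qed

lemma joinable_cball:
  fixes x y :: "'a::metric_space"
  assumes "geodesic_space TYPE('a)"
  shows "joinable (cball x (dist x y)) (dist x y) x y"
proof -
  obtain a b and \<gamma> :: "real \<Rightarrow> 'a"
    where ab: "a \<le> b" and \<gamma>: "geodesic {a..b} \<gamma>" "\<gamma> a = x" "\<gamma> b = y"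
    using assms unfolding geodesic_space_def by metis
  have dist: "dist x (\<gamma> u) = u - a" if "u \<in> {a..b}" for u
  proof -
    have "dist (\<gamma> a) (\<gamma> u) = \<bar>a - u\<bar>"
      using \<gamma>(1) ab that unfolding geodesic_iff by (meson atLeastAtMost_iff order_refl)
    then show ?thesis
      using \<gamma>(2) that by simp
  qed
  then have "dist x y = b - a"
    using \<gamma>(3) ab by force
  moreover have "\<gamma> ` {a..b} \<subseteq> cball x (dist x y)"
    using dist \<open>dist x y = b - a\<close> by auto
  ultimately show ?thesis
    using joinable_mono[OF joinable_geodesic_segment[OF ab \<gamma>(1)]] \<gamma> by simp
qed

section \<open>Divergence under quasi-isometric embeddings\<close>

text \<open>The chain is thinned out greedily: the slack \<open>\<rho>\<close> records the length walked since the last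
  chosen point \<open>x j\<close>, and a new point is chosen once it reaches \<open>1\<close>. So the number of chosen
  points, and with it the accumulated additive error, is bounded by the length of the chain.\<close>

lemma joinable_chain_image:
  fixes \<Phi> :: "'a::metric_space \<Rightarrow> 'b::metric_space"
  assumes geod: "geodesic_space TYPE('b)" and \<Phi>: "qi_embedding_on K L UNIV \<Phi>"
    and step: "\<And>i. i < n \<Longrightarrow> dist (x i) (x (Suc i)) < 1"
    and S: "\<And>i. i \<le> n \<Longrightarrow> cball (\<Phi> (x i)) (2 * K + L) \<subseteq> S"
  shows "joinable S ((2 * K + L) * ((\<Sum>i<n. dist (x i) (x (Suc i))) + 1)) (\<Phi> (x 0)) (\<Phi> (x n))"
proof -
  note P = qi_embedding_onD[OF \<Phi>]
  define A where "A = 2 * K + L"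
  define d where "d m = (\<Sum>i<m. dist (x i) (x (Suc i)))" for m
  have "0 \<le> A"
    using P(1,2) by (simp add: A_def)
  have jump: "joinable S (A * c) (\<Phi> (x i)) (\<Phi> y)" if "dist (x i) y \<le> 2" "1 \<le> c" "i \<le> n" for i y c
  proof -
    have "dist (\<Phi> (x i)) (\<Phi> y) \<le> A"
      using qi_embedding_on_dist_le[OF \<Phi> _ _ that(1)] by (simp add: A_def mult.commute)
    moreover have "A \<le> A * c"
      using mult_left_mono[OF that(2) \<open>0 \<le> A\<close>] by simp
    ultimately show ?thesis
      using S[OF that(3)] subset_cball[of "dist (\<Phi> (x i)) (\<Phi> y)" A]
      by (intro joinable_mono[OF joinable_cball[OF geod]]) (auto simp: A_def)
  qed
  have "\<exists>j\<le>m. \<exists>\<rho>. 0 \<le> \<rho> \<and> \<rho> < 1 \<and> dist (x j) (x m) \<le> \<rho> \<and>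
      joinable S (A * (d m - \<rho>)) (\<Phi> (x 0)) (\<Phi> (x j))" if "m \<le> n" for m
    using that
  proof (induction m)
    case 0
    have "\<Phi> (x 0) \<in> S"
      using S[of 0] \<open>0 \<le> A\<close> by (auto simp: A_def)
    moreover have "path_length (\<lambda>_. \<Phi> (x 0)) \<le> ennreal 0"
      by (intro path_length_lipschitz lipschitz_onI) auto
    ultimately have "joinable S 0 (\<Phi> (x 0)) (\<Phi> (x 0))"
      unfolding joinable_def
      by (intro conjI exI[of _ "\<lambda>_. \<Phi> (x 0)"])
        (auto simp: path_def pathstart_def pathfinish_def path_image_def)
    then show ?case
      by (auto simp: d_def)
  next
    case (Suc m)
    then obtain j \<rho> where j: "j \<le> m" and \<rho>: "0 \<le> \<rho>" "\<rho> < 1" "dist (x j) (x m) \<le> \<rho>"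
      and join: "joinable S (A * (d m - \<rho>)) (\<Phi> (x 0)) (\<Phi> (x j))"
      by auto
    define \<rho>' where "\<rho>' = \<rho> + dist (x m) (x (Suc m))"
    have \<rho>': "0 \<le> \<rho>'" "\<rho>' < 2" "dist (x j) (x (Suc m)) \<le> \<rho>'" "d (Suc m) - \<rho>' = d m - \<rho>"
      using \<rho> step[of m] Suc.prems dist_triangle[of "x j" "x (Suc m)" "x m"]
      by (auto simp: \<rho>'_def d_def)
    show ?case
    proof (cases "\<rho>' < 1")
      case True
      then show ?thesis
        using \<rho>' j join by (intro exI[of _ j] exI[of _ \<rho>'] conjI) auto
    next
      case False
      then have "joinable S (A * (d m - \<rho>) + A * \<rho>') (\<Phi> (x 0)) (\<Phi> (x (Suc m)))"
        using \<rho>' j Suc.prems by (intro joinable_trans[OF join] jump) auto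
      also have "A * (d m - \<rho>) + A * \<rho>' = A * (d (Suc m) - 0)"
        unfolding \<rho>'(4)[symmetric] by (simp add: algebra_simps)
      finally show ?thesis
        by (intro exI[of _ "Suc m"] exI[of _ 0]) auto
    qed
  qed
  then obtain j \<rho> where j: "j \<le> n" and \<rho>: "0 \<le> \<rho>" "\<rho> < 1" "dist (x j) (x n) \<le> \<rho>"
    and join: "joinable S (A * (d n - \<rho>)) (\<Phi> (x 0)) (\<Phi> (x j))"
    by blast
  have "joinable S (A * (d n - \<rho>) + A * (1 + \<rho>)) (\<Phi> (x 0)) (\<Phi> (x n))"
    using \<rho> j by (intro joinable_trans[OF join] jump) auto
  also have "A * (d n - \<rho>) + A * (1 + \<rho>) = A * (d n + 1)"
    by (simp add: algebra_simps)
  finally show ?thesis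
    by (simp add: A_def d_def)
qed

lemma joinable_path_image:
  fixes \<Phi> :: "'a::metric_space \<Rightarrow> 'b::metric_space"
  assumes geod: "geodesic_space TYPE('b)" and \<Phi>: "qi_embedding_on K L UNIV \<Phi>"
    and p: "path p" "path_length p = ennreal l" and "0 \<le> l"
    and S: "\<And>z. z \<in> path_image p \<Longrightarrow> cball (\<Phi> z) (2 * K + L) \<subseteq> S"
  shows "joinable S ((2 * K + L) * (l + 1)) (\<Phi> (pathstart p)) (\<Phi> (pathfinish p))"
proof -
  note P = qi_embedding_onD[OF \<Phi>]
  have "uniformly_continuous_on {0..1} p"
    using p(1) unfolding path_def by (intro compact_uniformly_continuous) auto
  then obtain e where e: "0 < e"
    "\<And>v w. v \<in> {0..1} \<Longrightarrow> w \<in> {0..1} \<Longrightarrow> dist w v < e \<Longrightarrow> dist (p w) (p v) < 1"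
    unfolding uniformly_continuous_on_def by (metis zero_less_one)
  obtain n where n: "0 < n" "inverse (real n) < e"
    using ex_inverse_of_nat_less[OF e(1)] by auto
  define u where "u i = real i / real n" for i
  have u: "mono_on {..n} u" "u ` {..n} \<subseteq> {0..1}"
    using n by (auto simp: mono_on_def u_def divide_simps)
  have "dist (p (u i)) (p (u (Suc i))) < 1" if "i < n" for i
  proof (rule e(2))
    show "u i \<in> {0..1}" "u (Suc i) \<in> {0..1}"
      using u(2) that by (auto simp: image_subset_iff)
    have "dist (u i) (u (Suc i)) = inverse (real n)"
      by (simp add: u_def dist_real_def add_divide_distrib inverse_eq_divide)
    then show "dist (u i) (u (Suc i)) < e"
      using n(2) by simp
  qed
  moreover have "p (u i) \<in> path_image p" if "i \<le> n" for i
    using u(2) that by (auto simp: path_image_def image_subset_iff)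
  ultimately have
    "joinable S ((2 * K + L) * ((\<Sum>i<n. dist (p (u i)) (p (u (Suc i)))) + 1)) (\<Phi> (p (u 0))) (\<Phi> (p (u n)))"
    using S by (intro joinable_chain_image[OF geod \<Phi>, where x = "\<lambda>i. p (u i)"]) auto
  moreover have "(\<Sum>i<n. dist (p (u i)) (p (u (Suc i)))) \<le> l"
    using path_length_ge[OF u, of p] p(2) \<open>0 \<le> l\<close> by (simp add: sum_nonneg)
  then have "(2 * K + L) * ((\<Sum>i<n. dist (p (u i)) (p (u (Suc i)))) + 1) \<le> (2 * K + L) * (l + 1)"
    using P(1,2) by (intro mult_left_mono) auto
  moreover have "u 0 = 0" "u n = 1"
    using n by (auto simp: u_def)
  ultimately show ?thesis
    by (simp add: pathstart_def pathfinish_def joinable_mono)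
qed

lemma rho_le:
  assumes "joinable (- ball (\<gamma> t) r) l (\<gamma> (t - r)) (\<gamma> (t + r))"
  shows "rho \<gamma> r t \<le> ennreal l"
proof -
  obtain p where "path p" "pathstart p = \<gamma> (t - r)" "pathfinish p = \<gamma> (t + r)"
    "path_image p \<subseteq> - ball (\<gamma> t) r" "path_length p \<le> ennreal l"
    using assms by (auto simp: joinable_def)
  then show ?thesis
    unfolding rho_def by (intro INF_lower2[of p]) auto
qed

lemma le_affine_INF_ennreal:
  fixes f :: "'i \<Rightarrow> ennreal"
  assumes "0 < A" and le: "\<And>i. i \<in> I \<Longrightarrow> y \<le> ennreal A * f i + ennreal c"
  shows "y \<le> ennreal A * (INF i\<in>I. f i) + ennreal c"
proof -
  have A: "ennreal A \<noteq> 0" "ennreal A \<noteq> top" "0 < ennreal A"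
    using \<open>0 < A\<close> by auto
  have "(y - ennreal c) / ennreal A \<le> (INF i\<in>I. f i)"
  proof (rule INF_greatest)
    fix i assume "i \<in> I"
    then have "y - ennreal c \<le> ennreal A * f i"
      using le by (simp add: ennreal_minus_le_iff add.commute)
    then show "(y - ennreal c) / ennreal A \<le> f i"
      using A by (intro divide_le_posI_ennreal)
  qed
  then have "ennreal A * ((y - ennreal c) / ennreal A) \<le> ennreal A * (INF i\<in>I. f i)"
    by (rule mult_left_mono) simp
  moreover have "ennreal A * ((y - ennreal c) / ennreal A) = y - ennreal c"
    using A mult_divide_eq_ennreal[of "ennreal A" "y - ennreal c"]
    by (simp add: ennreal_times_divide mult.commute)
  ultimately show ?thesis
    by (simp add: ennreal_minus_le_iff add.commute)
qed

text \<open>A path avoiding the ball of radius \<open>2 * K * x\<close> is pushed forward and then extended along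
  \<open>\<gamma>'\<close> to the points at distance \<open>x\<close> from the centre; its ends lie on opposite sides of the
  centre by \<open>qi_embedding_between\<close>. The factor \<open>2\<close> absorbs all additive errors for large \<open>x\<close>,
  so that the image avoids the ball of radius exactly \<open>x\<close>.\<close>

lemma ldiv_preceq:
  fixes \<gamma> :: "real \<Rightarrow> 'a::metric_space" and \<gamma>' :: "real \<Rightarrow> 'b::metric_space"
  assumes geod: "geodesic_space TYPE('b)" and \<Phi>: "qi_embedding_on K L UNIV \<Phi>"
    and \<gamma>: "geodesic UNIV \<gamma>" and \<gamma>': "geodesic UNIV \<gamma>'"
    and "0 \<le> C" and close: "\<And>t. \<exists>t'. dist (\<Phi> (\<gamma> t)) (\<gamma>' t') \<le> C"
  shows "ldiv \<gamma>' \<preceq>\<^sub>d ldiv \<gamma>"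
proof -
  note P = qi_embedding_onD[OF \<Phi>]
  obtain h where h: "\<And>t. dist (\<Phi> (\<gamma> t)) (\<gamma>' (h t)) \<le> C"
    using close by metis
  define L' where "L' = L + 2 * C"
  have "qi_embedding_on (K * 1) (K * 0 + L) UNIV (\<lambda>t. \<Phi> (\<gamma> t))"
    using \<gamma> by (intro qi_embedding_on_compose[OF _ \<Phi>]) (simp add: quasi_geodesic_def)
  then have "qi_embedding_on (1 * (K * 1)) (1 * (K * 0 + L + 0 + 2 * C)) UNIV h"
    using \<gamma>' \<open>0 \<le> C\<close> h by (intro qi_embedding_on_shadow[where g = \<gamma>']) (auto simp: quasi_geodesic_def)
  then have qih: "qi_embedding_on K L' UNIV h"
    by (simp add: L'_def)
  note H = qi_embedding_onD[OF qih]
  define A where "A = 2 * K + L"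
  define B where "B = 2 * K"
  define D where "D = 1 + K * (K + 2 * L') + L' + L + A + C"
  define E where "E = A + 2 * (2 * K * K + L' + C)"
  have pos: "0 < A" "0 < B" "0 < D" "0 < E"
  proof -
    show "0 < A" "0 < B"
      using P(1,2) by (simp_all add: A_def B_def)
    moreover have "0 \<le> K * (K + 2 * L')" "0 \<le> K * K"
      using P(1) H(2) by simp_all
    ultimately show "0 < D" "0 < E"
      using P(2) H(2) \<open>0 \<le> C\<close> by (simp_all add: D_def E_def add_pos_nonneg)
  qed
  have bound: "rho \<gamma>' x (h t) \<le> ennreal A * path_length p + ennreal (E * x)"
    if x: "D < x" and p: "path p" "pathstart p = \<gamma> (t - B * x)" "pathfinish p = \<gamma> (t + B * x)"
      "path_image p \<inter> ball (\<gamma> t) (B * x) = {}" for x t p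
  proof (cases "path_length p")
    case top
    then show ?thesis
      using pos by (simp add: ennreal_mult_top)
  next
    case (real l)
    have "0 \<le> K * (K + 2 * L')"
      using H(1,2) by simp
    then have x': "1 \<le> x" "K * (K + 2 * L') < x" "L' + C \<le> x" "L + A + C \<le> x"
      using x H(2) P(2) pos(1) \<open>0 \<le> C\<close> unfolding D_def by linarith+
    define S where "S = - ball (\<gamma>' (h t)) x"
    define w where "w = 2 * K * K * x + L'"
    have "cball (\<Phi> z) A \<subseteq> S" if "z \<in> path_image p" for z
    proof -
      have "B * x \<le> dist z (\<gamma> t)"
        using p(4) that by (force simp: dist_commute)
      also have "\<dots> \<le> K * (dist (\<Phi> z) (\<Phi> (\<gamma> t)) + L)"
        using P(4) by simp
      finally have "K * (2 * x) \<le> K * (dist (\<Phi> z) (\<Phi> (\<gamma> t)) + L)"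
        by (simp add: B_def mult_ac)
      then have "2 * x - L \<le> dist (\<Phi> z) (\<Phi> (\<gamma> t))"
        using P(1) by simp
      then have "x \<le> dist (\<gamma>' (h t)) y" if "dist (\<Phi> z) y \<le> A" for y
        using that h[of t] x' dist_triangle[of "\<Phi> z" "\<Phi> (\<gamma> t)" y]
          dist_triangle[of y "\<Phi> (\<gamma> t)" "\<gamma>' (h t)"] by (simp add: dist_commute)
      then show ?thesis
        unfolding S_def by (meson ComplI linorder_not_le mem_ball mem_cball subsetI)
    qed
    then have middle: "joinable S (A * (l + 1)) (\<Phi> (\<gamma> (t - B * x))) (\<Phi> (\<gamma> (t + B * x)))"
      using joinable_path_image[OF geod \<Phi> p(1) real(2,1), of S] p by (simp add: A_def)
    have far: "2 * x - L' \<le> \<bar>h e - h t\<bar>" "\<bar>h e - h t\<bar> \<le> w" if "\<bar>e - t\<bar> = B * x" for e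
    proof -
      have "K * (2 * x) \<le> K * (\<bar>h e - h t\<bar> + L')"
        using H(4)[of e t] that by (simp add: dist_real_def B_def mult_ac)
      then show "2 * x - L' \<le> \<bar>h e - h t\<bar>"
        using P(1) by simp
      show "\<bar>h e - h t\<bar> \<le> w"
        using H(3)[of e t] that by (simp add: dist_real_def B_def w_def mult_ac)
    qed
    have hop: "joinable S C (\<gamma>' (h e)) (\<Phi> (\<gamma> e))" if e: "\<bar>e - t\<bar> = B * x" for e
    proof (rule joinable_mono[OF joinable_cball[OF geod]])
      show "dist (\<gamma>' (h e)) (\<Phi> (\<gamma> e)) \<le> C"
        using h by (simp add: dist_commute)
      have "x \<le> dist (\<gamma>' (h t)) y" if y: "dist (\<gamma>' (h e)) y \<le> C" for y
        using y far(1)[OF e] x' dist_triangle[of "\<gamma>' (h e)" "\<gamma>' (h t)" y]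
          geodesic_UNIV_dist[OF \<gamma>', of "h e" "h t"] by (simp add: dist_commute)
      then show "cball (\<gamma>' (h e)) (dist (\<gamma>' (h e)) (\<Phi> (\<gamma> e))) \<subseteq> S"
        using h[of e] unfolding S_def
        by (metis ComplI dist_commute linorder_not_le mem_ball mem_cball order_trans subsetI)
    qed
    have leg: "joinable S (w + C) (\<gamma>' v) (\<Phi> (\<gamma> e))"
      if e: "\<bar>e - t\<bar> = B * x" and v: "v = h t + x \<and> h t < h e \<or> v = h t - x \<and> h e < h t" for e v
    proof (rule joinable_trans[OF joinable_mono[OF joinable_geodesic_line[OF \<gamma>']] hop[OF e]])
      show "\<bar>v - h e\<bar> \<le> w"
        using v far[OF e] x' \<open>0 \<le> C\<close> by auto
      have "x \<le> \<bar>h t - u\<bar>" if "u \<in> closed_segment v (h e)" for u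
        using that v far(1)[OF e] x' \<open>0 \<le> C\<close>
        by (auto simp: closed_segment_eq_real_ivl split: if_splits)
      then show "\<gamma>' ` closed_segment v (h e) \<subseteq> S"
        using geodesic_UNIV_dist[OF \<gamma>'] by (force simp: S_def)
    qed
    have "x \<le> B * x"
      using P(1) x' by (simp add: B_def)
    then have Bx: "K * (K + 2 * L') < B * x"
        "\<bar>(t - B * x) - t\<bar> = B * x" "\<bar>(t + B * x) - t\<bar> = B * x"
      using x' by linarith+
    have "h (t - B * x) < h t \<and> h t < h (t + B * x) \<or> h (t + B * x) < h t \<and> h t < h (t - B * x)"
      using qi_embedding_between[OF qih, of t "t - B * x" "t + B * x"] Bx by simp
    then have "joinable S (w + C + (A * (l + 1) + (w + C))) (\<gamma>' (h t - x)) (\<gamma>' (h t + x))"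
    proof
      assume "h (t - B * x) < h t \<and> h t < h (t + B * x)"
      then show ?thesis
        using leg[OF Bx(2), of "h t - x"] leg[OF Bx(3), of "h t + x"] middle
        by (blast intro: joinable_trans joinable_sym)
    next
      assume "h (t + B * x) < h t \<and> h t < h (t - B * x)"
      then show ?thesis
        using leg[OF Bx(2), of "h t + x"] leg[OF Bx(3), of "h t - x"] middle
        by (blast intro: joinable_trans joinable_sym)
    qed
    then have "rho \<gamma>' x (h t) \<le> ennreal (w + C + (A * (l + 1) + (w + C)))"
      unfolding S_def by (rule rho_le)
    also have "\<dots> \<le> ennreal (A * l + E * x)"
    proof (rule ennreal_leI)
      have "(A + 2 * L' + 2 * C) * 1 \<le> (A + 2 * L' + 2 * C) * x"
        using x' pos H(2) \<open>0 \<le> C\<close> by (intro mult_left_mono) auto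
      then show "w + C + (A * (l + 1) + (w + C)) \<le> A * l + E * x"
        by (simp add: w_def E_def algebra_simps)
    qed
    also have "\<dots> = ennreal A * path_length p + ennreal (E * x)"
      using real pos x' by (simp add: ennreal_plus ennreal_mult)
    finally show ?thesis .
  qed
  have "ldiv \<gamma>' x \<le> ennreal A * ldiv \<gamma> (B * x) + ennreal (E * x)" if "D < x" for x
    unfolding ldiv_def[of \<gamma>] rho_def
  proof (intro le_affine_INF_ennreal pos)
    fix t p assume "p \<in> {p. path p \<and> pathstart p = \<gamma> (t - B * x) \<and> pathfinish p = \<gamma> (t + B * x) \<and>
      path_image p \<inter> ball (\<gamma> t) (B * x) = {}}"
    then have "rho \<gamma>' x (h t) \<le> ennreal A * path_length p + ennreal (E * x)"
      using bound[OF that] by blast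
    moreover have "ldiv \<gamma>' x \<le> rho \<gamma>' x (h t)"
      unfolding ldiv_def by (rule INF_lower) simp
    ultimately show "ldiv \<gamma>' x \<le> ennreal A * path_length p + ennreal (E * x)"
      by (rule order_trans[rotated])
  qed
  then show ?thesis
    unfolding preceq_fun_def using pos by blast
qed

section \<open>Invariance of the divergence spectrum\<close>

lemma preceq_fun_trans:
  assumes "f \<preceq>\<^sub>d g" and "g \<preceq>\<^sub>d h"
  shows "f \<preceq>\<^sub>d h"
proof -
  obtain A B C D where pos: "0 < A" "0 < B" "0 < C" "0 < D"
    and f: "\<And>x. D < x \<Longrightarrow> f x \<le> ennreal A * g (B * x) + ennreal (C * x)"
    using assms(1) unfolding preceq_fun_def by blast
  obtain A' B' C' D' where pos': "0 < A'" "0 < B'" "0 < C'" "0 < D'"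
    and g: "\<And>x. D' < x \<Longrightarrow> g x \<le> ennreal A' * h (B' * x) + ennreal (C' * x)"
    using assms(2) unfolding preceq_fun_def by blast
  have "f x \<le> ennreal (A * A') * h (B' * B * x) + ennreal ((A * C' * B + C) * x)"
    if "max D (D' / B) < x" for x
  proof -
    have x: "D < x" "D' < B * x" "0 < x"
      using that pos by (auto simp: field_simps)
    have "f x \<le> ennreal A * g (B * x) + ennreal (C * x)"
      using f x by simp
    also have "\<dots> \<le> ennreal A * (ennreal A' * h (B' * (B * x)) + ennreal (C' * (B * x))) + ennreal (C * x)"
      using g x by (intro add_right_mono mult_left_mono) auto
    also have "\<dots> = ennreal (A * A') * h (B' * B * x) + ennreal ((A * C' * B + C) * x)"
      using pos pos' x by (simp add: distrib_left distrib_right ennreal_mult ennreal_plus mult_ac add_ac)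
    finally show ?thesis .
  qed
  moreover have "0 < A * A'" "0 < B' * B" "0 < A * C' * B + C" "0 < max D (D' / B)"
    using pos pos' by (auto simp: add_pos_pos)
  ultimately show ?thesis
    unfolding preceq_fun_def by blast
qed

lemma quasi_isometry_coarse_inverse:
  fixes \<Phi> :: "'a::metric_space \<Rightarrow> 'b::metric_space"
  assumes "quasi_isometry K L \<Phi>"
  shows "\<exists>C \<Psi>. 0 \<le> C \<and> qi_embedding_on K C UNIV \<Phi> \<and> qi_embedding_on K C UNIV \<Psi> \<and>
           (\<forall>x. dist (\<Psi> (\<Phi> x)) x \<le> C) \<and> (\<forall>y. dist (\<Phi> (\<Psi> y)) y \<le> C)"
proof -
  have \<Phi>: "qi_embedding_on K L UNIV \<Phi>" and "\<forall>y. \<exists>x. dist y (\<Phi> x) \<le> L"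
    using assms by (auto simp: quasi_isometry_def)
  then obtain \<Psi> where \<Psi>: "\<And>y. dist y (\<Phi> (\<Psi> y)) \<le> L"
    by metis
  note P = qi_embedding_onD[OF \<Phi>]
  define C where "C = K * (3 * L)"
  have "L * 1 \<le> L * K"
    using P(1,2) by (intro mult_left_mono) auto
  then have C: "L \<le> C" "0 \<le> C"
    using P(2) by (auto simp: C_def mult.commute)
  have "qi_embedding_on (K * 1) (K * (0 + L + 2 * L)) UNIV \<Psi>"
    by (rule qi_embedding_on_shadow[OF qi_embedding_on_id \<Phi> P(2)]) (rule \<Psi>)
  then have "qi_embedding_on K C UNIV \<Psi>"
    by (simp add: C_def)
  moreover have "qi_embedding_on K C UNIV \<Phi>"
    using qi_embedding_on_mono[OF \<Phi> order_refl C(1)] .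
  moreover have "dist (\<Psi> (\<Phi> x)) x \<le> C" for x
  proof -
    have "dist (\<Psi> (\<Phi> x)) x \<le> K * (dist (\<Phi> (\<Psi> (\<Phi> x))) (\<Phi> x) + L)"
      using P(4) by simp
    also have "\<dots> \<le> C"
      unfolding C_def using P(1,2) \<Psi>[of "\<Phi> x"] by (intro mult_left_mono) (auto simp: dist_commute)
    finally show ?thesis .
  qed
  moreover have "dist (\<Phi> (\<Psi> y)) y \<le> C" for y
    using \<Psi>[of y] C(1) by (simp add: dist_commute)
  ultimately show ?thesis
    using C(2) by blast
qed

lemma morse_geodesic_transfer:
  fixes \<Phi> :: "'a::metric_space \<Rightarrow> 'b::metric_space" and \<Psi> :: "'b \<Rightarrow> 'a"
  assumes geod_a: "geodesic_space TYPE('a)"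
    and proper: "proper_space TYPE('b)" and geod_b: "geodesic_space TYPE('b)"
    and \<Phi>: "qi_embedding_on K L UNIV \<Phi>" and \<Psi>: "qi_embedding_on K L UNIV \<Psi>"
    and "0 \<le> C" and inv: "\<And>x. dist (\<Psi> (\<Phi> x)) x \<le> C"
    and \<gamma>: "geodesic UNIV (\<gamma> :: real \<Rightarrow> 'a)" "morse UNIV \<gamma>"
  shows "\<exists>\<gamma>' :: real \<Rightarrow> 'b. geodesic UNIV \<gamma>' \<and> morse UNIV \<gamma>' \<and> ldiv \<gamma> \<sim>\<^sub>d ldiv \<gamma>'"
proof -
  note F = qi_embedding_onD[OF \<Phi>]
  define \<delta> where "\<delta> t = \<Phi> (\<gamma> t)" for t
  have "qi_embedding_on (K * 1) (K * 0 + L) UNIV \<delta>"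
    unfolding \<delta>_def using \<gamma>(1) by (intro qi_embedding_on_compose[OF _ \<Phi>]) (simp add: quasi_geodesic_def)
  then have \<delta>: "qi_embedding_on K L UNIV \<delta>"
    by simp
  have "morse UNIV \<delta>"
    using inv by (intro morse_transfer[OF \<Psi> \<gamma>(2) \<open>0 \<le> C\<close>]) (auto simp: \<delta>_def dist_commute)
  then obtain \<gamma>' M where \<gamma>': "geodesic UNIV \<gamma>'" and "0 \<le> M" and "\<forall>s. \<exists>t. dist (\<gamma>' s) (\<delta> t) \<le> M"
    using morse_quasi_line_shadowed_by_geodesic[OF proper geod_b \<delta>] by blast
  then obtain \<tau> where \<tau>: "\<And>s. dist (\<gamma>' s) (\<delta> (\<tau> s)) \<le> M"
    by metis
  have qi\<tau>: "qi_embedding_on (K * 1) (K * (0 + L + 2 * M)) UNIV \<tau>"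
    using \<gamma>' \<tau> \<open>0 \<le> M\<close> by (intro qi_embedding_on_shadow[OF _ \<delta>]) (auto simp: quasi_geodesic_def)
  define J where "J = K + K * (L + 2 * M)"
  define C1 C2 C3 where "C1 = M + K * J + L" and "C2 = K * M + L + C" and "C3 = C + K * C1 + L"
  have nonneg: "0 \<le> C1" "0 \<le> C2" "0 \<le> C3"
    using F(1,2) \<open>0 \<le> M\<close> \<open>0 \<le> C\<close> by (auto simp: C1_def C2_def C3_def J_def)
  have near1: "\<exists>s. dist (\<Phi> (\<gamma> t)) (\<gamma>' s) \<le> C1" for t
  proof -
    obtain s where s: "\<bar>\<tau> s - t\<bar> \<le> J"
      using qi_embedding_real_coarsely_surj[OF qi\<tau>, of t] by (auto simp: J_def)
    have "dist (\<delta> (\<tau> s)) (\<delta> t) \<le> K * J + L"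
      using s by (intro qi_embedding_on_dist_le[OF \<delta>]) (auto simp: dist_real_def)
    then show ?thesis
      using \<tau>[of s] dist_triangle[of "\<delta> t" "\<gamma>' s" "\<delta> (\<tau> s)"]
      by (intro exI[of _ s]) (simp add: C1_def \<delta>_def dist_commute)
  qed
  have near2: "\<exists>t. dist (\<Psi> (\<gamma>' s)) (\<gamma> t) \<le> C2" for s
  proof -
    have "dist (\<Psi> (\<gamma>' s)) (\<Psi> (\<delta> (\<tau> s))) \<le> K * M + L"
      using \<tau> by (intro qi_embedding_on_dist_le[OF \<Psi>]) auto
    then show ?thesis
      using inv[of "\<gamma> (\<tau> s)"] dist_triangle[of "\<Psi> (\<gamma>' s)" "\<gamma> (\<tau> s)" "\<Psi> (\<delta> (\<tau> s))"]
      by (intro exI[of _ "\<tau> s"]) (simp add: C2_def \<delta>_def)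
  qed
  have near3: "\<exists>s. dist (\<gamma> t) (\<Psi> (\<gamma>' s)) \<le> C3" for t
  proof -
    obtain s where s: "dist (\<Phi> (\<gamma> t)) (\<gamma>' s) \<le> C1"
      using near1 by blast
    have "dist (\<Psi> (\<Phi> (\<gamma> t))) (\<Psi> (\<gamma>' s)) \<le> K * C1 + L"
      using s by (intro qi_embedding_on_dist_le[OF \<Psi>]) auto
    then show ?thesis
      using inv[of "\<gamma> t"] dist_triangle[of "\<gamma> t" "\<Psi> (\<gamma>' s)" "\<Psi> (\<Phi> (\<gamma> t))"]
      by (intro exI[of _ s]) (simp add: C3_def dist_commute)
  qed
  have "morse UNIV \<gamma>'"
  proof (rule morse_transfer[OF \<Psi> \<gamma>(2)])
    show "0 \<le> max C2 C3"
      using nonneg by simp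
    show "\<exists>t'. dist (\<Psi> (\<gamma>' t)) (\<gamma> t') \<le> max C2 C3" "\<exists>t'. dist (\<gamma> t) (\<Psi> (\<gamma>' t')) \<le> max C2 C3" for t
      using near2[of t] near3[of t] by (auto simp: le_max_iff_disj)
  qed
  moreover have "ldiv \<gamma>' \<preceq>\<^sub>d ldiv \<gamma>"
    by (rule ldiv_preceq[OF geod_b \<Phi> \<gamma>(1) \<gamma>' nonneg(1) near1])
  moreover have "ldiv \<gamma> \<preceq>\<^sub>d ldiv \<gamma>'"
    by (rule ldiv_preceq[OF geod_a \<Psi> \<gamma>' \<gamma>(1) nonneg(2) near2])
  ultimately show ?thesis
    using \<gamma>' unfolding sim_fun_def by blast
qed

lemma divergence_spectrum_mono:
  fixes \<Phi> :: "'a::metric_space \<Rightarrow> 'b::metric_space" and \<Psi> :: "'b \<Rightarrow> 'a"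
  assumes "geodesic_space TYPE('a)" and "proper_space TYPE('b)" and "geodesic_space TYPE('b)"
    and "qi_embedding_on K L UNIV \<Phi>" and "qi_embedding_on K L UNIV \<Psi>"
    and "0 \<le> C" and "\<And>x. dist (\<Psi> (\<Phi> x)) x \<le> C"
  shows "divergence_spectrum TYPE('a) \<subseteq> divergence_spectrum TYPE('b)"
proof
  fix f assume f: "f \<in> divergence_spectrum TYPE('a)"
  then obtain \<gamma> :: "real \<Rightarrow> 'a" where \<gamma>: "geodesic UNIV \<gamma>" "morse UNIV \<gamma>" "f \<sim>\<^sub>d ldiv \<gamma>"
    by (auto simp: divergence_spectrum_def)
  obtain \<gamma>' :: "real \<Rightarrow> 'b" where "geodesic UNIV \<gamma>'" "morse UNIV \<gamma>'" "ldiv \<gamma> \<sim>\<^sub>d ldiv \<gamma>'"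
    using morse_geodesic_transfer[OF assms \<gamma>(1,2)] by blast
  moreover from this have "f \<sim>\<^sub>d ldiv \<gamma>'"
    using \<gamma>(3) unfolding sim_fun_def by (blast intro: preceq_fun_trans)
  ultimately show "f \<in> divergence_spectrum TYPE('b)"
    using f unfolding divergence_spectrum_def by blast
qed

theorem theorem3p4:
  assumes "proper_space TYPE('a::metric_space)" and "geodesic_space TYPE('a)"
    and "proper_space TYPE('b::metric_space)" and "geodesic_space TYPE('b)"
    and "quasi_isometric TYPE('a) TYPE('b)"
  shows "divergence_spectrum TYPE('a) = divergence_spectrum TYPE('b)"
proof -
  obtain K L and \<Phi> :: "'a \<Rightarrow> 'b" where "quasi_isometry K L \<Phi>"
    using assms(5) unfolding quasi_isometric_def by blast
  then obtain C \<Psi> where "0 \<le> C" "qi_embedding_on K C UNIV \<Phi>" "qi_embedding_on K C UNIV \<Psi>"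
    "\<And>x. dist (\<Psi> (\<Phi> x)) x \<le> C" "\<And>y. dist (\<Phi> (\<Psi> y)) y \<le> C"
    using quasi_isometry_coarse_inverse by metis
  then show ?thesis
    using assms by (intro equalityI divergence_spectrum_mono)
qed

end
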